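(* Let $F$ be a CNF with $n$ variables whose incidence graph has pathwidth $p$. Then $F$ can be compiled into an OBDD of size $O(2^p n)$.
   Context: The incidence graph of a CNF has a vertex for each variable and a vertex for each clause, a variable vertex being adjacent to a clause vertex iff the variable occurs in the clause. Pathwidth is the minimum width (maximum bag size minus one) of a path decomposition. An OBDD is an ordered binary decision diagram: a rooted DAG with two sinks labelled $true$ and $false$, internal nodes labelled by variables with two outgoing edges labelled $true$/$false$, variables along each root-to-sink path respecting a fixed linear order, computing the function whose satisfying assignments are those read along root-to-$true$ paths; its size is its number of nodes. *)

theory Defs
  imports Complex_Main
begin

section \<open>CNF formulas\<close>

datatype 'v literal = Pos 'v | Neg 'v

type_synonym 'v clause = "'v literal set"
type_synonym 'v cnf = "'v clause set"

fun lit_var :: "'v literal \<Rightarrow> 'v" where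
  "lit_var (Pos x) = x"
| "lit_var (Neg x) = x"

fun lit_true :: "('v \<Rightarrow> bool) \<Rightarrow> 'v literal \<Rightarrow> bool" where
  "lit_true a (Pos x) = a x"
| "lit_true a (Neg x) = (\<not> a x)"

definition is_cnf :: "'v cnf \<Rightarrow> bool" where
  "is_cnf F \<longleftrightarrow> finite F \<and> (\<forall>c\<in>F. finite c)"

definition clause_vars :: "'v clause \<Rightarrow> 'v set" where
  "clause_vars c = lit_var ` c"

definition cnf_vars :: "'v cnf \<Rightarrow> 'v set" where
  "cnf_vars F = (\<Union>c\<in>F. clause_vars c)"

definition satisfies :: "('v \<Rightarrow> bool) \<Rightarrow> 'v cnf \<Rightarrow> bool" where
  "satisfies a F \<longleftrightarrow> (\<forall>c\<in>F. \<exists>l\<in>c. lit_true a l)"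


section \<open>Incidence graphs and pathwidth\<close>

text \<open>An undirected simple graph is a pair of a vertex set and a set of two-element edges.\<close>

type_synonym 'a ugraph = "'a set \<times> 'a set set"

definition incidence_graph :: "'v cnf \<Rightarrow> ('v + 'v clause) ugraph" where
  "incidence_graph F =
    (Inl ` cnf_vars F \<union> Inr ` F,
     {{Inl x, Inr c} | x c. c \<in> F \<and> x \<in> clause_vars c})"

definition path_decomposition :: "'a ugraph \<Rightarrow> 'a set list \<Rightarrow> bool" where
  "path_decomposition G Xs \<longleftrightarrow>
     Xs \<noteq> [] \<and>
     \<Union>(set Xs) = fst G \<and>
     (\<forall>e\<in>snd G. \<exists>X\<in>set Xs. e \<subseteq> X) \<and>
     (\<forall>i j k. i \<le> j \<and> j \<le> k \<and> k < length Xs \<longrightarrow> Xs ! i \<inter> Xs ! k \<subseteq> Xs ! j)"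

text \<open>Subtraction on \<open>nat\<close> truncates, which matters only for the graph without vertices
  (width \<open>0\<close> instead of \<open>-1\<close>).\<close>

definition pd_width :: "'a set list \<Rightarrow> nat" where
  "pd_width Xs = Max (card ` set Xs) - 1"

definition pathwidth :: "'a ugraph \<Rightarrow> nat" where
  "pathwidth G = (LEAST w. \<exists>Xs. path_decomposition G Xs \<and> pd_width Xs = w)"


section \<open>Ordered binary decision diagrams\<close>

text \<open>The fields \<open>bdd_var\<close> and \<open>bdd_succ\<close> are relevant only on internal nodes;
  \<open>bdd_succ B u b\<close> is the head of the outgoing edge of \<open>u\<close> labelled \<open>b\<close>.\<close>

record ('n, 'v) bdd =
  bdd_nodes :: "'n set"
  bdd_root  :: "'n"
  bdd_true  :: "'n"
  bdd_false :: "'n"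
  bdd_var   :: "'n \<Rightarrow> 'v"
  bdd_succ  :: "'n \<Rightarrow> bool \<Rightarrow> 'n"

definition bdd_internal :: "('n, 'v) bdd \<Rightarrow> 'n set" where
  "bdd_internal B = bdd_nodes B - {bdd_true B, bdd_false B}"

definition bdd_edges :: "('n, 'v) bdd \<Rightarrow> ('n \<times> 'n) set" where
  "bdd_edges B = {(u, bdd_succ B u b) | u b. u \<in> bdd_internal B}"

text \<open>\<open>bdd_path B u ps w\<close>: there is a directed path from \<open>u\<close> to \<open>w\<close> along which the
  variable/value pairs \<open>ps\<close> are read.\<close>

inductive bdd_path :: "('n, 'v) bdd \<Rightarrow> 'n \<Rightarrow> ('v \<times> bool) list \<Rightarrow> 'n \<Rightarrow> bool"
  for B :: "('n, 'v) bdd" where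
  Nil: "bdd_path B u [] u"
| Cons: "u \<in> bdd_internal B \<Longrightarrow> bdd_path B (bdd_succ B u b) ps w
    \<Longrightarrow> bdd_path B u ((bdd_var B u, b) # ps) w"

text \<open>Every internal node is reachable from the root. The sinks are exempt, as the diagram of a
  constant function has a sink that no path reaches.\<close>

definition is_bdd :: "('n, 'v) bdd \<Rightarrow> bool" where
  "is_bdd B \<longleftrightarrow>
     finite (bdd_nodes B) \<and>
     bdd_root B \<in> bdd_nodes B \<and> bdd_true B \<in> bdd_nodes B \<and> bdd_false B \<in> bdd_nodes B \<and>
     bdd_true B \<noteq> bdd_false B \<and>
     (\<forall>u\<in>bdd_internal B. \<forall>b. bdd_succ B u b \<in> bdd_nodes B) \<and>
     acyclic (bdd_edges B) \<and>
     (\<forall>u\<in>bdd_internal B. (bdd_root B, u) \<in> (bdd_edges B)\<^sup>*)"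

text \<open>The relation \<open>r\<close> is a reflexive linear order on \<open>V\<close>; variables increase strictly along
  paths, so none is read twice.\<close>

definition is_obdd :: "'v set \<Rightarrow> ('v \<times> 'v) set \<Rightarrow> ('n, 'v) bdd \<Rightarrow> bool" where
  "is_obdd V r B \<longleftrightarrow>
     is_bdd B \<and> linear_order_on V r \<and>
     (\<forall>u\<in>bdd_internal B. bdd_var B u \<in> V) \<and>
     (\<forall>ps w. bdd_path B (bdd_root B) ps w \<and> w \<in> {bdd_true B, bdd_false B} \<longrightarrow>
        sorted_wrt (\<lambda>x y. (x, y) \<in> r \<and> x \<noteq> y) (map fst ps))"

definition bdd_accepts :: "('n, 'v) bdd \<Rightarrow> ('v \<Rightarrow> bool) \<Rightarrow> bool" where
  "bdd_accepts B a \<longleftrightarrow>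
     (\<exists>ps. bdd_path B (bdd_root B) ps (bdd_true B) \<and> (\<forall>(x, b)\<in>set ps. a x = b))"

definition bdd_computes :: "('n, 'v) bdd \<Rightarrow> 'v cnf \<Rightarrow> bool" where
  "bdd_computes B F \<longleftrightarrow> (\<forall>a. bdd_accepts B a \<longleftrightarrow> satisfies a F)"

definition bdd_size :: "('n, 'v) bdd \<Rightarrow> nat" where
  "bdd_size B = card (bdd_nodes B)"

end

theory Submission
  imports Defs
begin

text \<open>Read the variables in the order of the first bag in which they occur, and let the nodes of
  the diagram be the pairs of a level and a satisfiable residual function at that level, together
  with the two sinks. When the next variable first occurs in bag \<open>X\<close>, a satisfiable residual is
  determined by the values of the variables in \<open>X\<close> already read and by the set of clauses in \<open>X\<close>
  already satisfied: a clause seen only before \<open>X\<close> has been read completely, and the variables read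
  so far of a clause seen only after \<open>X\<close> all lie in \<open>X\<close>. Hence each level has at most
  \<open>2 ^ card X\<close> nodes.\<close>

section \<open>Diagrams with a level and a meaning for each node\<close>

definition list_order :: "'a list \<Rightarrow> ('a \<times> 'a) set" where
  "list_order xs = {(xs ! i, xs ! j) | i j. i \<le> j \<and> j < length xs}"

lemma nth_in_list_order: "i \<le> j \<Longrightarrow> j < length xs \<Longrightarrow> (xs ! i, xs ! j) \<in> list_order xs"
  by (auto simp: list_order_def)

lemma linear_order_on_list_order:
  assumes "distinct xs"
  shows "linear_order_on (set xs) (list_order xs)"
proof -
  have "trans (list_order xs)"
  proof (rule transI)
    fix x y z assume "(x, y) \<in> list_order xs" "(y, z) \<in> list_order xs"
    then obtain i j j' k where "x = xs ! i" "y = xs ! j" "i \<le> j" "j < length xs"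
      "y = xs ! j'" "z = xs ! k" "j' \<le> k" "k < length xs"
      by (auto simp: list_order_def)
    moreover from this have "j = j'"
      using assms by (simp add: nth_eq_iff_index_eq)
    ultimately have "x = xs ! i \<and> z = xs ! k \<and> i \<le> k \<and> k < length xs" by simp
    then show "(x, z) \<in> list_order xs" by (auto simp: list_order_def)
  qed
  moreover have "antisym (list_order xs)"
    using assms by (auto simp: antisym_def list_order_def nth_eq_iff_index_eq)
  moreover have "list_order xs \<subseteq> set xs \<times> set xs"
    by (auto simp: list_order_def)
  moreover have "refl_on (set xs) (list_order xs)"
    by (auto simp: refl_on_def in_set_conv_nth intro: nth_in_list_order)
  moreover have "total_on (set xs) (list_order xs)"
  proof (rule total_onI)
    fix x y assume "x \<in> set xs" "y \<in> set xs"
    then obtain i j where "i < length xs" "j < length xs" "x = xs ! i" "y = xs ! j"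
      by (auto simp: in_set_conv_nth)
    then show "(x, y) \<in> list_order xs \<or> (y, x) \<in> list_order xs"
      using nth_in_list_order[of i j xs] nth_in_list_order[of j i xs] by (cases "i \<le> j") auto
  qed
  ultimately show ?thesis
    by (simp add: linear_order_on_def partial_order_on_def preorder_on_def)
qed

text \<open>Separates the OBDD conditions from any particular construction. A level that rises along
  every edge gives acyclicity and the variable order together; the branching law for
  \<open>meaning\<close> gives correctness. Edges may skip levels, so a failed branch can go
  straight to the false sink.\<close>

locale leveled_bdd =
  fixes B :: "('n, 'v) bdd" and xs :: "'v list"
    and level :: "'n \<Rightarrow> nat" and meaning :: "'n \<Rightarrow> ('v \<Rightarrow> bool) \<Rightarrow> bool"
  assumes distinct_vars: "distinct xs"
    and finite_nodes: "finite (bdd_nodes B)"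
    and root_in: "bdd_root B \<in> bdd_nodes B"
    and true_in: "bdd_true B \<in> bdd_nodes B"
    and false_in: "bdd_false B \<in> bdd_nodes B"
    and meaning_true: "meaning (bdd_true B) a"
    and meaning_false: "\<not> meaning (bdd_false B) a"
    and level_less: "u \<in> bdd_internal B \<Longrightarrow> level u < length xs"
    and var_level: "u \<in> bdd_internal B \<Longrightarrow> bdd_var B u = xs ! level u"
    and succ_in: "u \<in> bdd_internal B \<Longrightarrow> bdd_succ B u b \<in> bdd_nodes B"
    and succ_level: "u \<in> bdd_internal B \<Longrightarrow> level u < level (bdd_succ B u b)"
    and succ_meaning: "u \<in> bdd_internal B \<Longrightarrow> meaning (bdd_succ B u (a (bdd_var B u))) a = meaning u a"
    and reachable: "u \<in> bdd_internal B \<Longrightarrow> (bdd_root B, u) \<in> (bdd_edges B)\<^sup>*"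
begin

lemma acyclic_edges: "acyclic (bdd_edges B)"
proof (rule acyclic_subset)
  show "acyclic (measure level)"
    by (simp add: wf_acyclic)
  show "bdd_edges B \<subseteq> measure level"
    using succ_level by (auto simp: bdd_edges_def)
qed

text \<open>The second conjunct carries the induction: everything read after an edge stands at a
  position no less than the level of its head, hence strictly after the variable read at its
  tail.\<close>

lemma path_sorted:
  assumes "bdd_path B u ps w"
  shows "sorted_wrt (\<lambda>x y. (x, y) \<in> list_order xs \<and> x \<noteq> y) (map fst ps)
    \<and> (\<forall>(x, b)\<in>set ps. \<exists>i. level u \<le> i \<and> i < length xs \<and> x = xs ! i)"
  using assms
proof induction
  case (Cons u b ps w)
  let ?i = "level u" and ?j = "level (bdd_succ B u b)"
  have i: "?i < length xs" "bdd_var B u = xs ! ?i" "?i < ?j"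
    using Cons.hyps level_less var_level succ_level by auto
  have later: "(xs ! ?i, x) \<in> list_order xs \<and> xs ! ?i \<noteq> x
      \<and> (\<exists>k. ?i \<le> k \<and> k < length xs \<and> x = xs ! k)" if "(x, c) \<in> set ps" for x c
  proof -
    from Cons.IH that obtain k where k: "?j \<le> k" "k < length xs" "x = xs ! k" by auto
    with i have "?i < k" by simp
    then show ?thesis
      using i k distinct_vars nth_in_list_order[of ?i k xs]
      by (auto simp: nth_eq_iff_index_eq intro!: exI[of _ k])
  qed
  then have "\<forall>(x, c)\<in>set ps. \<exists>k. ?i \<le> k \<and> k < length xs \<and> x = xs ! k"
    by blast
  moreover have "\<forall>x\<in>set (map fst ps). (xs ! ?i, x) \<in> list_order xs \<and> xs ! ?i \<noteq> x"
  proof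
    fix x assume "x \<in> set (map fst ps)"
    then obtain c where "(x, c) \<in> set ps" by auto
    then show "(xs ! ?i, x) \<in> list_order xs \<and> xs ! ?i \<noteq> x" using later by blast
  qed
  ultimately show ?case using Cons.IH i by auto
qed auto

text \<open>Exactly one edge out of an internal node agrees with \<open>a\<close>, and the branching
  law carries the meaning along it until a sink is reached.\<close>

lemma meaning_iff_path:
  assumes "u \<in> bdd_nodes B"
  shows "meaning u a \<longleftrightarrow> (\<exists>ps. bdd_path B u ps (bdd_true B) \<and> (\<forall>(x, b)\<in>set ps. a x = b))"
  using assms
proof (induction "length xs - level u" arbitrary: u rule: less_induct)
  case less
  show ?case
  proof (cases "u \<in> bdd_internal B")
    case True
    let ?v = "bdd_succ B u (a (bdd_var B u))"
    \<comment> \<open>Levels of internal nodes stay below \<open>length xs\<close>, so the measure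
      drops strictly even where it is truncated to 0 at a sink.\<close>
    have "length xs - level ?v < length xs - level u"
      using succ_level[OF True] level_less[OF True] by (simp add: diff_less_mono2)
    with less.hyps[OF this] succ_in[OF True] succ_meaning[OF True]
    have "meaning u a \<longleftrightarrow> (\<exists>ps. bdd_path B ?v ps (bdd_true B) \<and> (\<forall>(x, b)\<in>set ps. a x = b))"
      by simp
    also have "\<dots> \<longleftrightarrow> (\<exists>ps. bdd_path B u ps (bdd_true B) \<and> (\<forall>(x, b)\<in>set ps. a x = b))"
    proof
      assume "\<exists>ps. bdd_path B ?v ps (bdd_true B) \<and> (\<forall>(x, b)\<in>set ps. a x = b)"
      then obtain ps where ps: "bdd_path B ?v ps (bdd_true B)" "\<forall>(x, b)\<in>set ps. a x = b" by blast
      then show "\<exists>ps. bdd_path B u ps (bdd_true B) \<and> (\<forall>(x, b)\<in>set ps. a x = b)"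
        by (intro exI[of _ "(bdd_var B u, a (bdd_var B u)) # ps"] conjI bdd_path.Cons True) auto
    next
      assume "\<exists>ps. bdd_path B u ps (bdd_true B) \<and> (\<forall>(x, b)\<in>set ps. a x = b)"
      then obtain ps where ps: "bdd_path B u ps (bdd_true B)" "\<forall>(x, b)\<in>set ps. a x = b" by blast
      from ps(1) show "\<exists>ps. bdd_path B ?v ps (bdd_true B) \<and> (\<forall>(x, b)\<in>set ps. a x = b)"
      proof cases
        case Nil
        then show ?thesis using True by (simp add: bdd_internal_def)
      next
        case (Cons b ps')
        then show ?thesis using ps(2) by auto
      qed
    qed
    finally show ?thesis .
  next
    case False
    then have "u = bdd_true B \<or> u = bdd_false B"
      using less.prems by (auto simp: bdd_internal_def)
    moreover have "bdd_path B u ps w \<longleftrightarrow> ps = [] \<and> w = u" for ps w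
      using False by (auto elim: bdd_path.cases intro: bdd_path.Nil)
    moreover have "bdd_true B \<noteq> bdd_false B"
      using meaning_true meaning_false by metis
    ultimately show ?thesis
      using meaning_true meaning_false by auto
  qed
qed

lemma is_obdd: "is_obdd (set xs) (list_order xs) B"
  unfolding is_obdd_def is_bdd_def
proof (intro conjI ballI allI impI)
  show "bdd_true B \<noteq> bdd_false B"
    using meaning_true meaning_false by metis
  show "bdd_var B u \<in> set xs" if "u \<in> bdd_internal B" for u
    using that level_less var_level by auto
qed (use finite_nodes root_in true_in false_in succ_in acyclic_edges reachable path_sorted
      linear_order_on_list_order[OF distinct_vars] in auto)

lemma accepts_iff: "bdd_accepts B a \<longleftrightarrow> meaning (bdd_root B) a"
  using meaning_iff_path[OF root_in] by (simp add: bdd_accepts_def)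

end


section \<open>The diagram of satisfiable residual functions\<close>

text \<open>The restriction of \<open>f\<close> by the values of \<open>a\<close> on
  \<open>S\<close>. It remains a function of total assignments that ignores its argument on
  \<open>S\<close>, so residuals of all levels share one type.\<close>

definition residual :: "(('v \<Rightarrow> bool) \<Rightarrow> bool) \<Rightarrow> 'v set \<Rightarrow> ('v \<Rightarrow> bool) \<Rightarrow> ('v \<Rightarrow> bool) \<Rightarrow> bool" where
  "residual f S a = (\<lambda>b. f (override_on b a S))"

text \<open>The constantly false residual is left out: the false sink represents it, and the later
  count could not bound it, since the state of a bag does not record failed clauses of earlier
  bags.\<close>

definition sat_residuals :: "(('v \<Rightarrow> bool) \<Rightarrow> bool) \<Rightarrow> 'v set \<Rightarrow> (('v \<Rightarrow> bool) \<Rightarrow> bool) set" where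
  "sat_residuals f S = residual f S ` {a. \<exists>b. residual f S a b}"

text \<open>Fixing an unread variable in a residual gives a residual of the next level, so branching
  never leaves the family.\<close>

lemma residual_fun_upd:
  assumes "x \<notin> S"
  shows "residual f S a (b(x := v)) = residual f (insert x S) (a(x := v)) b"
proof -
  have "override_on (b(x := v)) a S = override_on b (a(x := v)) (insert x S)"
    using assms by (auto simp: override_on_def)
  then show ?thesis by (simp add: residual_def)
qed

text \<open>Assignments with equal residuals share a node, which leaves at most \<open>M\<close>
  nodes per level besides the two sinks. By \<open>dep\<close>, the residual after all variables is
  constant, so the sinks suffice at the end.\<close>

lemma ex_obdd_of_residuals:
  fixes f :: "('v \<Rightarrow> bool) \<Rightarrow> bool"
  assumes dist: "distinct xs"
    and dep: "\<And>a b. (\<And>x. x \<in> set xs \<Longrightarrow> a x = b x) \<Longrightarrow> f a = f b"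
    and fin: "\<And>i. i < length xs \<Longrightarrow> finite (sat_residuals f (set (take i xs)))"
    and card: "\<And>i. i < length xs \<Longrightarrow> card (sat_residuals f (set (take i xs))) \<le> M"
  shows "\<exists>B :: (nat, 'v) bdd. is_obdd (set xs) (list_order xs) B \<and>
    (\<forall>a. bdd_accepts B a \<longleftrightarrow> f a) \<and> bdd_size B \<le> length xs * M + 2"
proof -
  define n where "n = length xs"
  define S where "S i = set (take i xs)" for i
  define I where "I = (SIGMA i : {..<n}. sat_residuals f (S i))"
  \<comment> \<open>Level \<open>n\<close> exceeds all internal levels, so edges into sinks rise too
    and no sink lies in \<open>I\<close>.\<close>
  define T :: "nat \<times> (('v \<Rightarrow> bool) \<Rightarrow> bool)" where "T = (n, \<lambda>_. True)"
  define Z :: "nat \<times> (('v \<Rightarrow> bool) \<Rightarrow> bool)" where "Z = (n, \<lambda>_. False)"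
  \<comment> \<open>An unsatisfiable function goes to \<open>Z\<close> from any level; a satisfiable
    residual at level \<open>n\<close> is constantly true, so its pair is \<open>T\<close>
    itself.\<close>
  define mk where "mk i g = (if \<exists>b. g b then (i, g) else Z)"
    for i :: nat and g :: "('v \<Rightarrow> bool) \<Rightarrow> bool"
  define nxt where "nxt u v = mk (Suc (fst u)) (\<lambda>b. snd u (b(xs ! fst u := v)))" for u v
  define N where "N = insert T (insert Z I)"
  have finI: "finite I"
    unfolding I_def S_def n_def using fin by (intro finite_SigmaI) auto
  then have finN: "finite N" by (simp add: N_def)
  have "card I = (\<Sum>i<n. card (sat_residuals f (S i)))"
    unfolding I_def S_def n_def by (rule card_SigmaI) (auto simp: fin)
  also have "\<dots> \<le> (\<Sum>i<n. M)"
    unfolding S_def n_def by (rule sum_mono) (auto simp: card)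
  finally have "card I \<le> n * M" by simp
  moreover have "T \<notin> I" "Z \<notin> I" "T \<noteq> Z"
    by (auto simp: I_def T_def Z_def fun_eq_iff)
  ultimately have cardN: "card N \<le> n * M + 2"
    using finI by (simp add: N_def)
  have I_eq: "N - {T, Z} = I"
    using \<open>T \<notin> I\<close> \<open>Z \<notin> I\<close> by (auto simp: N_def)
  have S_Suc: "S (Suc i) = insert (xs ! i) (S i)" "xs ! i \<notin> S i" if "i < n" for i
    using that dist unfolding S_def n_def
    by (auto simp: take_Suc_conv_app_nth in_set_conv_nth nth_eq_iff_index_eq)
  have mk_in: "mk i (residual f (S i) a) \<in> N" if "i \<le> n" for i a
  proof (cases "i < n")
    case True
    then show ?thesis by (auto simp: mk_def N_def I_def sat_residuals_def)
  next
    case False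
    with that have [simp]: "i = n" by simp
    have "residual f (S n) a b = f a" for b
      unfolding residual_def S_def n_def by (rule dep) (simp add: override_on_def)
    then have "residual f (S n) a = (\<lambda>_. f a)" by blast
    then show ?thesis by (cases "f a") (simp_all add: mk_def N_def T_def)
  qed
  have nxt_residual:
    "nxt (i, residual f (S i) a) v = mk (Suc i) (residual f (S (Suc i)) (a(xs ! i := v)))"
    if "i < n" for i a v
    by (simp add: nxt_def residual_fun_upd S_Suc that)
  have I_cases: "\<exists>i a. i < n \<and> u = (i, residual f (S i) a) \<and> (\<exists>b. residual f (S i) a b)"
    if "u \<in> I" for u
    using that by (auto simp: I_def sat_residuals_def)
  have nxt_in: "nxt u v \<in> N" if "u \<in> I" for u v
    using I_cases[OF that] nxt_residual mk_in by (metis Suc_leI)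
  have mk_root: "mk 0 f \<in> N"
    using mk_in[of 0 undefined] by (simp add: S_def residual_def)
  obtain enc :: "_ \<Rightarrow> nat" where enc: "inj_on enc N"
    using finite_imp_inj_to_nat_seg[OF finN] by blast
  define dec where "dec = inv_into N enc"
  have dec_enc [simp]: "dec (enc u) = u" if "u \<in> N" for u
    unfolding dec_def using enc that by simp
  define B :: "(nat, 'v) bdd" where
    "B = \<lparr>bdd_nodes = enc ` N, bdd_root = enc (mk 0 f), bdd_true = enc T, bdd_false = enc Z,
      bdd_var = (\<lambda>u. xs ! fst (dec u)), bdd_succ = (\<lambda>u v. enc (nxt (dec u) v))\<rparr>"
  have TZ: "T \<in> N" "Z \<in> N" by (auto simp: N_def)
  have IN: "u \<in> N" if "u \<in> I" for u using that by (simp add: N_def)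
  have internal: "bdd_internal B = enc ` I"
    unfolding bdd_internal_def I_eq[symmetric] using enc TZ
    by (auto simp: B_def inj_on_eq_iff)
  have edge: "(enc u, enc (nxt u v)) \<in> bdd_edges B" if "u \<in> I" for u v
    unfolding bdd_edges_def internal using that IN[OF that]
    by (auto simp: B_def intro!: exI[of _ "enc u"] exI[of _ v])
  \<comment> \<open>Follow \<open>a\<close> from the root: if a residual is satisfiable, so are
    those of all shorter prefixes, and the walk never falls into \<open>Z\<close>.\<close>
  have reach: "(enc (mk 0 f), enc (i, residual f (S i) a)) \<in> (bdd_edges B)\<^sup>*"
    if "i \<le> n" "\<exists>b. residual f (S i) a b" for i a
    using that
  proof (induction i)
    case 0
    then show ?case by (auto simp: S_def residual_def mk_def)
  next
    case (Suc i)
    have i: "i < n" using Suc.prems by simp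
    have upd: "nxt (i, residual f (S i) a) (a (xs ! i)) = (Suc i, residual f (S (Suc i)) a)"
      using Suc.prems i by (simp add: nxt_residual mk_def)
    \<comment> \<open>A completion of the longer prefix, updated at \<open>xs ! i\<close> to the
      value of \<open>a\<close>, completes the shorter one.\<close>
    have ex: "\<exists>b. residual f (S i) a b"
      using Suc.prems(2) residual_fun_upd[of "xs ! i" "S i" f a _ "a (xs ! i)"] S_Suc[OF i]
      by (metis fun_upd_triv)
    then have "(i, residual f (S i) a) \<in> I"
      using i by (auto simp: I_def sat_residuals_def)
    from edge[OF this, of "a (xs ! i)"] show ?case
      using Suc.IH ex i by (simp add: upd rtrancl_into_rtrancl)
  qed
  interpret leveled_bdd B xs "fst \<circ> dec" "snd \<circ> dec"
  proof
    show "finite (bdd_nodes B)" "bdd_root B \<in> bdd_nodes B" "bdd_true B \<in> bdd_nodes B"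
      "bdd_false B \<in> bdd_nodes B"
      using finN mk_root TZ by (auto simp: B_def)
    show "(snd \<circ> dec) (bdd_true B) a" "\<not> (snd \<circ> dec) (bdd_false B) a" for a
      using TZ by (auto simp: B_def) (auto simp: T_def Z_def)
  next
    fix u assume "u \<in> bdd_internal B"
    then obtain w where w: "w \<in> I" "u = enc w" by (auto simp: internal)
    then have [simp]: "dec u = w" using IN by simp
    from w(1) have less: "fst w < n" by (auto simp: I_def)
    then show "(fst \<circ> dec) u < length xs" by (simp add: n_def)
    show "bdd_var B u = xs ! (fst \<circ> dec) u" by (simp add: B_def)
    show "bdd_succ B u b \<in> bdd_nodes B" for b
      using nxt_in w(1) by (simp add: B_def)
    show "(fst \<circ> dec) u < (fst \<circ> dec) (bdd_succ B u b)" for b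
      using nxt_in[OF w(1), of b] less by (simp add: B_def) (simp add: nxt_def mk_def Z_def)
    show "(snd \<circ> dec) (bdd_succ B u (a (bdd_var B u))) a = (snd \<circ> dec) u a" for a
    proof -
      \<comment> \<open>Settles edges redirected to \<open>Z\<close>: updating \<open>a\<close> with
        its own value changes nothing, so an unsatisfiable branch forces \<open>snd w a\<close> to
        be false.\<close>
      have "\<exists>b. snd w (b(xs ! fst w := a (xs ! fst w)))" if "snd w a"
        using that by (metis fun_upd_triv)
      then show ?thesis
        using nxt_in[OF w(1), of "a (xs ! fst w)"]
        by (simp add: B_def) (auto simp: nxt_def mk_def Z_def)
    qed
    show "(bdd_root B, u) \<in> (bdd_edges B)\<^sup>*"
    proof -
      have "(enc (mk 0 f), enc w) \<in> (bdd_edges B)\<^sup>*"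
        using I_cases[OF w(1)] reach by (metis less_imp_le)
      then show ?thesis using w(2) by (simp add: B_def)
    qed
  qed (fact dist)
  have "bdd_accepts B a \<longleftrightarrow> f a" for a
    using accepts_iff[of a] mk_root by (simp add: B_def) (auto simp: mk_def Z_def)
  moreover have "bdd_size B \<le> length xs * M + 2"
    using cardN enc by (simp add: bdd_size_def B_def card_image n_def)
  ultimately show ?thesis using is_obdd by blast
qed


section \<open>Counting residual functions along a path decomposition\<close>

lemma lit_true_cong: "a (lit_var l) = b (lit_var l) \<Longrightarrow> lit_true a l = lit_true b l"
  by (cases l) auto

text \<open>On \<open>A\<close>, \<open>h\<close> factors through \<open>key\<close>; choosing a
  representative of each key gives a map on \<open>K\<close> that attains every value of
  \<open>h\<close> on \<open>A\<close>.\<close>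

lemma card_image_le_card_keys:
  assumes "finite K" and "key ` A \<subseteq> K"
    and "\<And>a b. a \<in> A \<Longrightarrow> b \<in> A \<Longrightarrow> key a = key b \<Longrightarrow> h a = h b"
  shows "finite (h ` A)" "card (h ` A) \<le> card K"
proof -
  have *: "h ` A \<subseteq> (\<lambda>k. h (SOME a. a \<in> A \<and> key a = k)) ` K"
  proof
    fix y assume "y \<in> h ` A"
    then obtain a where a: "a \<in> A" "y = h a" by blast
    let ?b = "SOME b. b \<in> A \<and> key b = key a"
    have "?b \<in> A \<and> key ?b = key a"
      by (rule someI[of _ a]) (simp add: a)
    then have "y = h ?b" using a assms(3) by metis
    then show "y \<in> (\<lambda>k. h (SOME a. a \<in> A \<and> key a = k)) ` K"
      using a assms(2) by blast
  qed
  show "finite (h ` A)" using * assms(1) finite_surj by blast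
  show "card (h ` A) \<le> card K" using * assms(1) by (rule surj_card_le[rotated])
qed

text \<open>Meant for \<open>S\<close> a prefix of the variables sorted by first bag and
  \<open>t\<close> the first bag of the next variable. Variables first occurring in bag
  \<open>t\<close> may be on either side.\<close>

context
  fixes F :: "'v cnf" and Xs :: "('v + 'v clause) set list" and S :: "'v set" and t :: nat
  assumes pd: "path_decomposition (incidence_graph F) Xs"
    and t: "t < length Xs"
    and read: "\<And>x. x \<in> S \<Longrightarrow> \<exists>k\<le>t. Inl x \<in> Xs ! k"
    and unread: "\<And>x k. x \<notin> S \<Longrightarrow> k < length Xs \<Longrightarrow> Inl x \<in> Xs ! k \<Longrightarrow> t \<le> k"
begin

text \<open>One subset of the bag encodes both kinds of information, one bit per element, hence at
  most \<open>2 ^ card (Xs ! t)\<close> states.\<close>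

definition bag_state :: "('v \<Rightarrow> bool) \<Rightarrow> ('v + 'v clause) set" where
  "bag_state a = {z \<in> Xs ! t. case z of
     Inl x \<Rightarrow> x \<in> S \<and> a x
   | Inr c \<Rightarrow> \<exists>l\<in>c. lit_var l \<in> S \<and> lit_true a l}"

lemma bag_convex: "i \<le> j \<Longrightarrow> j \<le> k \<Longrightarrow> k < length Xs \<Longrightarrow> z \<in> Xs ! i \<Longrightarrow> z \<in> Xs ! k \<Longrightarrow> z \<in> Xs ! j"
  using pd unfolding path_decomposition_def by blast

lemma common_bag:
  assumes "c \<in> F" "l \<in> c"
  obtains k where "k < length Xs" "Inl (lit_var l) \<in> Xs ! k" "Inr c \<in> Xs ! k"
proof -
  have "{Inl (lit_var l), Inr c} \<in> snd (incidence_graph F)"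
    using assms by (auto simp: incidence_graph_def clause_vars_def)
  then obtain X where "X \<in> set Xs" "{Inl (lit_var l), Inr c} \<subseteq> X"
    using pd unfolding path_decomposition_def by blast
  then show thesis using that by (auto simp: in_set_conv_nth)
qed

text \<open>Half of the equality of two residuals; the other half is symmetric. Only clauses
  satisfied by \<open>a\<close> through a read literal need care, according to their place relative
  to bag \<open>t\<close>. The completion \<open>b'\<close> certifies that \<open>a'\<close>
  falsifies no fully read clause.\<close>

lemma residual_le_of_bag_state_eq:
  assumes state: "bag_state a = bag_state a'"
    and sat: "residual (\<lambda>a. satisfies a F) S a b"
    and sat': "residual (\<lambda>a. satisfies a F) S a' b'"
  shows "residual (\<lambda>a. satisfies a F) S a' b"
  unfolding residual_def satisfies_def
proof
  fix c assume c: "c \<in> F"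
  obtain l where l: "l \<in> c" "lit_true (override_on b a S) l"
    using sat c by (auto simp: residual_def satisfies_def)
  obtain l' where l': "l' \<in> c" "lit_true (override_on b' a' S) l'"
    using sat' c by (auto simp: residual_def satisfies_def)
  have on: "lit_true (override_on e d S) m = lit_true d m" if "lit_var m \<in> S" for d e m
    using that by (intro lit_true_cong) (simp add: override_on_def)
  have off: "lit_true (override_on e d S) m = lit_true e m" if "lit_var m \<notin> S" for d e m
    using that by (intro lit_true_cong) (simp add: override_on_def)
  show "\<exists>l\<in>c. lit_true (override_on b a' S) l"
  proof (cases "lit_var l \<in> S")
    case False
    then show ?thesis using l off by auto
  next
    case True
    consider "Inr c \<in> Xs ! t" | k where "k < t" "Inr c \<in> Xs ! k" "Inr c \<notin> Xs ! t"
      | "\<And>k. k \<le> t \<Longrightarrow> Inr c \<notin> Xs ! k"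
      by (metis le_neq_implies_less)
    then show ?thesis
    proof cases
      \<comment> \<open>The state yields some read literal of \<open>c\<close> true under
        \<open>a'\<close>, not necessarily \<open>l\<close>.\<close>
      case 1
      with True l on have "Inr c \<in> bag_state a" by (auto simp: bag_state_def)
      with state have "Inr c \<in> bag_state a'" by simp
      then show ?thesis using on by (auto simp: bag_state_def)
    next
      \<comment> \<open>By convexity all bags of \<open>c\<close> precede \<open>t\<close>, so the
        variable of \<open>l'\<close> is read and \<open>l'\<close> is true under \<open>a'\<close>
        whatever the completion.\<close>
      case 2
      obtain j where j: "j < length Xs" "Inl (lit_var l') \<in> Xs ! j" "Inr c \<in> Xs ! j"
        using common_bag[OF c l'(1)] .
      then have "j < t" using 2 bag_convex[of k t j "Inr c"] by force
      then have "lit_var l' \<in> S" using unread j by (meson not_le)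
      then show ?thesis using l' on by auto
    next
      \<comment> \<open>All bags of \<open>c\<close> come after \<open>t\<close>, while the read
        variable of \<open>l\<close> occurs at or before \<open>t\<close>; convexity puts it into
        bag \<open>t\<close>, where the state fixes its value.\<close>
      case 3
      obtain j where j: "j < length Xs" "Inl (lit_var l) \<in> Xs ! j" "Inr c \<in> Xs ! j"
        using common_bag[OF c l(1)] .
      then have "t \<le> j" using 3 by (meson nat_le_linear)
      moreover obtain k where "k \<le> t" "Inl (lit_var l) \<in> Xs ! k" using read True by blast
      ultimately have "Inl (lit_var l) \<in> Xs ! t" using j bag_convex by blast
      then have "a (lit_var l) = a' (lit_var l)"
        using arg_cong[OF state, of "\<lambda>K. Inl (lit_var l) \<in> K"] True by (simp add: bag_state_def)
      then have "lit_true a' l" using l(2) True on lit_true_cong by metis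
      then show ?thesis using True l(1) on by auto
    qed
  qed
qed

lemma card_sat_residuals_le:
  assumes "finite (Xs ! t)"
  shows "finite (sat_residuals (\<lambda>a. satisfies a F) S)"
    "card (sat_residuals (\<lambda>a. satisfies a F) S) \<le> 2 ^ card (Xs ! t)"
proof -
  let ?h = "residual (\<lambda>a. satisfies a F) S"
  have fin: "finite (Pow (Xs ! t))" using assms by simp
  have key: "bag_state ` {a. \<exists>b. ?h a b} \<subseteq> Pow (Xs ! t)"
    by (auto simp: bag_state_def)
  have det: "?h a = ?h a'"
    if "a \<in> {a. \<exists>b. ?h a b}" "a' \<in> {a. \<exists>b. ?h a b}" "bag_state a = bag_state a'" for a a'
  proof
    fix b
    show "?h a b \<longleftrightarrow> ?h a' b"
      using that residual_le_of_bag_state_eq[of a a' b] residual_le_of_bag_state_eq[of a' a b] by auto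
  qed
  note count = card_image_le_card_keys[where h = ?h, OF fin key det]
  show "finite (sat_residuals (\<lambda>a. satisfies a F) S)"
    unfolding sat_residuals_def by (rule count(1))
  show "card (sat_residuals (\<lambda>a. satisfies a F) S) \<le> 2 ^ card (Xs ! t)"
    unfolding sat_residuals_def card_Pow[OF assms, symmetric] by (rule count(2))
qed

end

section \<open>Reading order from an optimal path decomposition, and the size bound\<close>

lemma finite_incidence_graph:
  assumes "is_cnf F"
  shows "finite (fst (incidence_graph F))"
  using assms by (auto simp: is_cnf_def incidence_graph_def cnf_vars_def clause_vars_def)

text \<open>The single bag of all vertices is a path decomposition, so the \<open>LEAST\<close> in
  \<open>pathwidth\<close> is attained.\<close>

lemma ex_path_decomposition_pathwidth:
  "\<exists>Xs. path_decomposition (incidence_graph F) Xs \<and> pd_width Xs = pathwidth (incidence_graph F)"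
proof -
  have "path_decomposition (incidence_graph F) [fst (incidence_graph F)]"
    by (auto simp: path_decomposition_def incidence_graph_def cnf_vars_def)
  then show ?thesis
    unfolding pathwidth_def
    by (intro LeastI_ex[of "\<lambda>w. \<exists>Xs. path_decomposition (incidence_graph F) Xs \<and> pd_width Xs = w"]) blast
qed

theorem cnf_obdd:
  fixes F :: "'v cnf"
  assumes cnf: "is_cnf F"
  shows "\<exists>r (B :: (nat, 'v) bdd). is_obdd (cnf_vars F) r B \<and> bdd_computes B F \<and>
    bdd_size B \<le> card (cnf_vars F) * 2 ^ (pathwidth (incidence_graph F) + 1) + 2"
proof -
  let ?f = "\<lambda>a. satisfies a F" and ?p = "pathwidth (incidence_graph F)"
  obtain Xs where pd: "path_decomposition (incidence_graph F) Xs" and w: "pd_width Xs = ?p"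
    using ex_path_decomposition_pathwidth by blast
  have bags: "\<Union>(set Xs) = fst (incidence_graph F)"
    using pd by (simp add: path_decomposition_def)
  have finbag: "finite X" if "X \<in> set Xs" for X
    using that bags finite_incidence_graph[OF cnf] by (metis Union_upper finite_subset)
  have cardbag: "card X \<le> ?p + 1" if "X \<in> set Xs" for X
  proof -
    have "card X \<le> Max (card ` set Xs)" using that by simp
    then show ?thesis using w by (simp add: pd_width_def)
  qed
  have "Inl ` cnf_vars F \<subseteq> \<Union>(set Xs)" by (auto simp: bags incidence_graph_def)
  then have occ: "\<exists>k. k < length Xs \<and> Inl x \<in> Xs ! k" if "x \<in> cnf_vars F" for x
    using that by (fastforce simp: in_set_conv_nth)
  define fb where "fb x = (LEAST k. k < length Xs \<and> Inl x \<in> Xs ! k)" for x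
  have fb: "fb x < length Xs" "Inl x \<in> Xs ! fb x" if "x \<in> cnf_vars F" for x
    using LeastI_ex[OF occ[OF that]] by (auto simp: fb_def)
  have fb_le: "fb x \<le> k" if "k < length Xs" "Inl x \<in> Xs ! k" for x k
    unfolding fb_def using that by (intro Least_le) simp
  have "finite (cnf_vars F)"
    using cnf by (auto simp: is_cnf_def cnf_vars_def clause_vars_def)
  then obtain ys where ys: "set ys = cnf_vars F" "distinct ys"
    using finite_distinct_list by blast
  \<comment> \<open>Variables with the same first bag may come in any order; what matters is that
    \<open>fb\<close> is monotone along the list.\<close>
  define xs where "xs = sort_key fb ys"
  have xs: "set xs = cnf_vars F" "distinct xs" "sorted (map fb xs)"
    using ys by (simp_all add: xs_def)
  have mono: "fb (xs ! i) \<le> fb (xs ! j)" if "i \<le> j" "j < length xs" for i j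
    using sorted_nth_mono[OF xs(3) that(1)] that by simp
  have bound: "finite (sat_residuals ?f (set (take i xs))) \<and>
      card (sat_residuals ?f (set (take i xs))) \<le> 2 ^ (?p + 1)" if i: "i < length xs" for i
  proof -
    let ?S = "set (take i xs)" and ?t = "fb (xs ! i)"
    have t: "?t < length Xs" using i xs(1) fb by (metis nth_mem)
    have read: "\<exists>k\<le>?t. Inl x \<in> Xs ! k" if "x \<in> ?S" for x
    proof -
      from that i obtain j where "j < i" "x = xs ! j" by (auto simp: in_set_conv_nth)
      moreover from this have "fb x \<le> ?t" "x \<in> cnf_vars F"
        using mono[of j i] i by (auto simp flip: xs(1))
      ultimately show ?thesis using fb(2) by blast
    qed
    \<comment> \<open>An occurring variable outside the prefix has a position at least
      \<open>i\<close>, so its first bag is not before \<open>?t\<close>, and no earlier bag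
      contains it.\<close>
    have unread: "?t \<le> k" if "x \<notin> ?S" "k < length Xs" "Inl x \<in> Xs ! k" for x k
    proof -
      have "Inl x \<in> fst (incidence_graph F)" using that(2,3) bags by (metis UnionI nth_mem)
      then have "x \<in> set xs" by (auto simp: xs(1) incidence_graph_def)
      then obtain j where j: "j < length xs" "x = xs ! j" by (auto simp: in_set_conv_nth)
      have "i \<le> j"
      proof (rule ccontr)
        assume "\<not> i \<le> j"
        then have "x \<in> ?S" using j nth_mem[of j "take i xs"] by simp
        with that(1) show False ..
      qed
      then show ?thesis using mono[of i j] j fb_le[OF that(2,3)] by simp
    qed
    have bag: "Xs ! ?t \<in> set Xs" using t by simp
    have "finite (sat_residuals ?f ?S)"
      by (rule card_sat_residuals_le(1)[OF pd t]) (fact read unread finbag[OF bag])+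
    moreover have "card (sat_residuals ?f ?S) \<le> 2 ^ card (Xs ! ?t)"
      by (rule card_sat_residuals_le(2)[OF pd t]) (fact read unread finbag[OF bag])+
    moreover have "(2::nat) ^ card (Xs ! ?t) \<le> 2 ^ (?p + 1)"
      by (rule power_increasing[OF cardbag[OF bag]]) simp
    ultimately show ?thesis by linarith
  qed
  have dep: "?f a = ?f b" if "\<And>x. x \<in> set xs \<Longrightarrow> a x = b x" for a b
  proof -
    have "lit_true a l = lit_true b l" if "c \<in> F" "l \<in> c" for c l
      using that \<open>\<And>x. x \<in> set xs \<Longrightarrow> a x = b x\<close> xs(1)
      by (intro lit_true_cong) (auto simp: cnf_vars_def clause_vars_def)
    then show ?thesis by (auto simp: satisfies_def)
  qed
  have len: "length xs = card (cnf_vars F)" using xs distinct_card by metis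
  have "\<exists>B :: (nat, 'v) bdd. is_obdd (set xs) (list_order xs) B \<and>
    (\<forall>a. bdd_accepts B a \<longleftrightarrow> ?f a) \<and> bdd_size B \<le> length xs * 2 ^ (?p + 1) + 2"
    by (rule ex_obdd_of_residuals[OF xs(2) dep]) (use bound in blast)+
  then show ?thesis
    unfolding bdd_computes_def xs(1) len by blast
qed

theorem theorem2:
  "\<exists>C::real. C > 0 \<and>
     (\<forall>(F :: 'v cnf) (n::nat) (p::nat).
        is_cnf F \<and> card (cnf_vars F) = n \<and> n \<ge> 1 \<and> pathwidth (incidence_graph F) = p \<longrightarrow>
        (\<exists>r (B :: (nat, 'v) bdd).
           is_obdd (cnf_vars F) r B \<and> bdd_computes B F \<and>
           real (bdd_size B) \<le> C * (2 ^ p * real n)))"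
proof (intro exI[of _ 4] conjI allI impI)
  fix F :: "'v cnf" and n p :: nat
  assume A: "is_cnf F \<and> card (cnf_vars F) = n \<and> n \<ge> 1 \<and> pathwidth (incidence_graph F) = p"
  then obtain r and B :: "(nat, 'v) bdd" where B: "is_obdd (cnf_vars F) r B" "bdd_computes B F"
    and size: "bdd_size B \<le> n * 2 ^ (p + 1) + 2"
    using cnf_obdd[of F] by blast
  \<comment> \<open>The constant 4: the exponent \<open>p + 1\<close> contributes a factor 2, and as
    \<open>n\<close> is positive the two sinks cost at most another
    \<open>2 * (2 ^ p * n)\<close>.\<close>
  have "1 * 1 \<le> 2 ^ p * n" using A by (intro mult_le_mono) auto
  moreover have "n * 2 ^ (p + 1) = 2 * (2 ^ p * n)" by simp
  ultimately have "bdd_size B \<le> 4 * (2 ^ p * n)" using size by linarith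
  then have "real (bdd_size B) \<le> real (4 * (2 ^ p * n))" by (rule of_nat_mono)
  then have "real (bdd_size B) \<le> 4 * (2 ^ p * real n)" by simp
  with B show "\<exists>r (B :: (nat, 'v) bdd). is_obdd (cnf_vars F) r B \<and> bdd_computes B F \<and>
      real (bdd_size B) \<le> 4 * (2 ^ p * real n)"
    by blast
qed simp

end
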